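(* Let $n,k,d$ be non-negative integers with $n\geq 2$, and let $G$ be a bipartite $(n,k,d)$-graph. Then for every edge $e$ of $G$, the graph $G-e$ is an $(n-2,k,d)$-graph.
   Context: All graphs are finite, undirected and simple. A $k$-matching is a matching with exactly $k$ edges. For a non-negative integer $d$, a defect-$d$ matching of a graph $H$ is a matching covering exactly $|V(H)|-d$ vertices of $H$. A matching $M$ extends to a matching $M'$ if $M\subseteq M'$. Let $n,k,d$ be non-negative integers. A graph $G$ is an $(n,k,d)$-graph if $|V(G)|\geq n+2k+d+2$, $|V(G)|-n-d$ is even, and for every set $S$ of $n$ vertices of $G$, the graph $H=G-S$ contains a $k$-matching and every $k$-matching of $H$ can be extended to a defect-$d$ matching of $H$. *)

theory Defs imports Main begin

record 'a ugraph =
  verts :: "'a set"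
  edges :: "'a set set"

definition simple_graph :: "'a ugraph \<Rightarrow> bool" where
  "simple_graph G \<longleftrightarrow>
     finite (verts G) \<and> (\<forall>e\<in>edges G. e \<subseteq> verts G \<and> card e = 2)"

definition bipartite :: "'a ugraph \<Rightarrow> bool" where
  "bipartite G \<longleftrightarrow>
     (\<exists>X Y. X \<union> Y = verts G \<and> X \<inter> Y = {} \<and>
        (\<forall>e\<in>edges G. \<exists>x\<in>X. \<exists>y\<in>Y. e = {x, y}))"

definition delete_verts :: "'a ugraph \<Rightarrow> 'a set \<Rightarrow> 'a ugraph" where
  "delete_verts G S = \<lparr>verts = verts G - S, edges = {e \<in> edges G. e \<inter> S = {}}\<rparr>"

definition delete_edge :: "'a ugraph \<Rightarrow> 'a set \<Rightarrow> 'a ugraph" where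
  "delete_edge G e = \<lparr>verts = verts G, edges = edges G - {e}\<rparr>"

definition matching :: "'a ugraph \<Rightarrow> 'a set set \<Rightarrow> bool" where
  "matching G M \<longleftrightarrow> M \<subseteq> edges G \<and> pairwise disjnt M"

definition k_matching :: "nat \<Rightarrow> 'a ugraph \<Rightarrow> 'a set set \<Rightarrow> bool" where
  "k_matching k G M \<longleftrightarrow> matching G M \<and> card M = k"

text \<open>The vertices covered by \<open>M\<close> are the elements of \<open>\<Union>M\<close>. The count is written
  additively so that a defect \<open>d\<close> larger than the number of vertices is impossible
  (truncated subtraction would admit the empty matching there).\<close>

definition defect_matching :: "nat \<Rightarrow> 'a ugraph \<Rightarrow> 'a set set \<Rightarrow> bool" where
  "defect_matching d G M \<longleftrightarrow> matching G M \<and> card (\<Union>M) + d = card (verts G)"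

text \<open>The subtraction in the parity condition does not truncate, because of the preceding
  lower bound on the number of vertices.\<close>

definition nkd_graph :: "nat \<Rightarrow> nat \<Rightarrow> nat \<Rightarrow> 'a ugraph \<Rightarrow> bool" where
  "nkd_graph n k d G \<longleftrightarrow>
     simple_graph G \<and>
     card (verts G) \<ge> n + 2 * k + d + 2 \<and>
     even (card (verts G) - n - d) \<and>
     (\<forall>S. S \<subseteq> verts G \<and> card S = n \<longrightarrow>
        (\<exists>M. k_matching k (delete_verts G S) M) \<and>
        (\<forall>M. k_matching k (delete_verts G S) M \<longrightarrow>
           (\<exists>M'. M \<subseteq> M' \<and> defect_matching d (delete_verts G S) M')))"

end

theory Submission imports Defs begin

text \<open>Delete a set \<open>T\<close> of \<open>n - 2\<close> vertices and let \<open>M\<close> be a \<open>k\<close>-matching of what is left of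
  \<open>G - e\<close>. If \<open>M\<close> does not extend to a defect-\<open>d\<close> matching, then by Koenig's theorem the
  edges other than \<open>e\<close> that avoid \<open>T\<close> and \<open>M\<close> have a vertex cover \<open>C\<close> that is too small
  by one. Deleting in addition an end of \<open>e\<close> and a further vertex of \<open>C\<close> (in total \<open>n\<close>
  vertices) destroys \<open>e\<close> and shrinks the cover, so that it becomes smaller than the matching
  that the \<open>(n, k, d)\<close>-property of \<open>G\<close> provides.\<close>

text \<open>Finiteness belongs to the notion because \<open>card\<close> of an infinite set is 0,
  which would defeat lower bounds on the size of covers.\<close>

definition vertex_cover :: "'a set set \<Rightarrow> 'a set \<Rightarrow> bool" where
  "vertex_cover E C \<longleftrightarrow> finite C \<and> (\<forall>e\<in>E. e \<inter> C \<noteq> {})"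

text \<open>Each edge of \<open>M\<close> picks a vertex of \<open>C\<close> lying on it, and
  disjoint edges pick different vertices.\<close>

lemma card_matching_le_cover:
  assumes "pairwise disjnt M" "vertex_cover M C"
  shows "card M \<le> card C"
proof -
  obtain f where f: "\<forall>e\<in>M. f e \<in> e \<inter> C"
    using bchoice[of M "\<lambda>e v. v \<in> e \<inter> C"] assms(2) unfolding vertex_cover_def by blast
  have "inj_on f M"
    using assms(1) f unfolding inj_on_def pairwise_def disjnt_def by (metis IntE disjoint_iff)
  then show ?thesis
    using f assms(2) card_inj_on_le[of f M C] unfolding vertex_cover_def by blast
qed

text \<open>Lovasz's argument: once every edge is critical for the cover number, two edges sharing
  a vertex \<open>x\<close> yield, from the symmetric difference of covers of \<open>E - {e}\<close> and
  \<open>E - {f}\<close>, a cover that is too small; so the edges form a matching.\<close>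

theorem koenig:
  assumes "finite E"
    and bip: "\<forall>e\<in>E. \<exists>a b. a \<in> X \<and> b \<notin> X \<and> e = {a, b}"
    and "\<And>C. vertex_cover E C \<Longrightarrow> k \<le> card C"
  shows "\<exists>M \<subseteq> E. pairwise disjnt M \<and> card M = k"
  using assms
proof (induction E rule: finite_psubset_induct)
  case (psubset E)
  show ?case
  proof (cases "\<exists>e\<in>E. \<forall>C. vertex_cover (E - {e}) C \<longrightarrow> k \<le> card C")
    case True
    then obtain e where e: "e \<in> E" "\<forall>C. vertex_cover (E - {e}) C \<longrightarrow> k \<le> card C" by blast
    have "\<exists>M \<subseteq> E - {e}. pairwise disjnt M \<and> card M = k"
      by (rule psubset.IH) (use e psubset.prems(1) in auto)
    then show ?thesis by blast
  next
    case False
    then have critical: "\<exists>C. vertex_cover (E - {e}) C \<and> card C < k" if "e \<in> E" for e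
      using that by (meson not_le)
    have "pairwise disjnt E"
    proof (rule pairwiseI, rule ccontr)
      fix e f assume ef: "e \<in> E" "f \<in> E" "e \<noteq> f" "\<not> disjnt e f"
      then obtain x where x: "x \<in> e" "x \<in> f" by (auto simp: disjnt_def)
      obtain A where A: "vertex_cover (E - {e}) A" "card A < k" using critical ef by blast
      obtain B where B: "vertex_cover (E - {f}) B" "card B < k" using critical ef by blast
      have fin: "finite A" "finite B" using A B by (auto simp: vertex_cover_def)
      have meetA: "g \<inter> A \<noteq> {}" if "g \<in> E" "g \<noteq> e" for g
        using A(1) that by (auto simp: vertex_cover_def)
      have meetB: "g \<inter> B \<noteq> {}" if "g \<in> E" "g \<noteq> f" for g
        using B(1) that by (auto simp: vertex_cover_def)
      have "\<not> vertex_cover E A" "\<not> vertex_cover E B"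
        using A(2) B(2) psubset.prems(2) not_le by blast+
      then have eA: "e \<inter> A = {}" and fB: "f \<inter> B = {}"
        using A(1) B(1) unfolding vertex_cover_def by blast+
      then have xAB: "x \<notin> A" "x \<notin> B" using x by auto
      define D where "D = insert x ((A - B) \<union> (B - A))"
      have finD: "finite D" using fin by (simp add: D_def)
      \<comment> \<open>The edge \<open>e\<close> misses \<open>A\<close> but contains
        \<open>x\<close> and meets \<open>B\<close>; symmetrically for \<open>f\<close>. Any other
        edge meets both \<open>A\<close> and \<open>B\<close>, either in a common vertex or with one
        end in each difference.\<close>
      have meetD: "g \<inter> (A \<inter> B) \<noteq> {} \<or> g \<subseteq> D" if g: "g \<in> E" for g
      proof -
        obtain a b where ab: "g = {a, b}" using psubset.prems(1) g by blast
        show ?thesis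
          using ab x eA fB xAB ef(3) meetA[OF g] meetB[OF g] unfolding D_def
          by (cases "g = e"; cases "g = f") auto
      qed
      \<comment> \<open>An edge inside \<open>D\<close> has an end on each side of the bipartition,
        so either half of \<open>D\<close> completes \<open>A \<inter> B\<close> to a cover.\<close>
      have cover: "vertex_cover E (A \<inter> B \<union> D \<inter> Z)" if Z: "Z = X \<or> Z = - X" for Z
        unfolding vertex_cover_def
      proof (intro conjI ballI)
        show "finite (A \<inter> B \<union> D \<inter> Z)" using fin finD by simp
        fix g assume g: "g \<in> E"
        then obtain a b where "a \<in> X" "b \<notin> X" "g = {a, b}" using psubset.prems(1) by blast
        then show "g \<inter> (A \<inter> B \<union> D \<inter> Z) \<noteq> {}" using meetD[OF g] Z by auto
      qed
      have "k \<le> card (A \<inter> B \<union> D \<inter> X)" "k \<le> card (A \<inter> B \<union> D \<inter> - X)"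
        using cover psubset.prems(2) by blast+
      \<comment> \<open>The two bounds are added; the right-hand side is at most
        \<open>card A + card B + 1\<close>, hence at most \<open>2 * k - 1\<close>.\<close>
      then have "2 * k \<le> 2 * card (A \<inter> B) + card (D \<inter> X) + card (D \<inter> - X)"
        using card_Un_le[of "A \<inter> B" "D \<inter> X"] card_Un_le[of "A \<inter> B" "D \<inter> - X"] by linarith
      moreover have "card (D \<inter> X) + card (D \<inter> - X) = card D"
        using card_Int_Diff[OF finD, of X] by (simp add: Diff_eq)
      moreover have "card D \<le> Suc (card (A - B) + card (B - A))"
        unfolding D_def using card_Un_le[of "A - B" "B - A"] fin
        by (simp add: card_insert_if)
      moreover have "card A = card (A \<inter> B) + card (A - B)"
        using fin by (intro card_Int_Diff)
      moreover have "card B = card (A \<inter> B) + card (B - A)"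
        using card_Int_Diff[OF fin(2), of A] by (simp add: Int_commute)
      ultimately show False using A(2) B(2) by linarith
    qed
    moreover have "k \<le> card E"
    \<comment> \<open>One end chosen from each edge gives a cover of at most \<open>card E\<close>
      vertices.\<close>
    proof -
      obtain h where h: "\<forall>e\<in>E. h e \<in> e" using psubset.prems(1) bchoice[of E "\<lambda>e v. v \<in> e"] by blast
      then have "vertex_cover E (h ` E)"
        using psubset.hyps by (auto simp: vertex_cover_def)
      then show ?thesis
        using psubset.prems(2) card_image_le[OF psubset.hyps, of h] order_trans by blast
    qed
    ultimately show ?thesis
      by (metis obtain_subset_with_card_n pairwise_subset)
  qed
qed

text \<open>Translates between edges, which Koenig's theorem counts, and covered vertices, which the
  defect counts.\<close>

lemma matching_card_Union:
  assumes "simple_graph G" "matching G M"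
  shows "finite M" "card (\<Union>M) = 2 * card M" "finite (\<Union>M)" "\<Union>M \<subseteq> verts G"
proof -
  have e: "e \<subseteq> verts G" "card e = 2" if "e \<in> M" for e
    using assms that unfolding simple_graph_def matching_def by blast+
  show sub: "\<Union>M \<subseteq> verts G" using e by blast
  then show fin: "finite (\<Union>M)"
    using assms(1) finite_subset unfolding simple_graph_def by blast
  then show "finite M" by (rule finite_UnionD)
  have "card (\<Union>M) = sum card M"
    using assms(2) fin unfolding matching_def
    by (intro card_Union_disjoint) (auto intro: finite_subset)
  also have "\<dots> = 2 * card M" using e(2) by simp
  finally show "card (\<Union>M) = 2 * card M" .
qed

lemma simple_graph_delete_edge: "simple_graph G \<Longrightarrow> simple_graph (delete_edge G e)"
  by (auto simp: simple_graph_def delete_edge_def)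

lemma matching_delete_verts:
  "matching (delete_verts G S) M \<longleftrightarrow> matching G M \<and> \<Union>M \<inter> S = {}"
  by (auto simp: matching_def delete_verts_def)

lemma matching_delete_edge:
  "matching (delete_edge G e) M \<longleftrightarrow> matching G M \<and> e \<notin> M"
  by (auto simp: matching_def delete_edge_def)

lemma verts_delete_verts: "verts (delete_verts G S) = verts G - S"
  by (simp add: delete_verts_def)

lemma verts_delete_edge: "verts (delete_edge G e) = verts G"
  by (simp add: delete_edge_def)

lemmas delete_simps = matching_delete_verts matching_delete_edge
  verts_delete_verts verts_delete_edge

theorem theorem4p2:
  fixes n k d :: nat and G :: "'a ugraph" and e :: "'a set"
  assumes "n \<ge> 2"
    and "nkd_graph n k d G"
    and "bipartite G"
    and "e \<in> edges G"
  shows "nkd_graph (n - 2) k d (delete_edge G e)"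
proof -
  let ?V = "verts G"
  have G: "simple_graph G" and size: "n + 2 * k + d + 2 \<le> card ?V"
    and parity: "even (card ?V - n - d)"
    and nkd: "\<forall>S. S \<subseteq> ?V \<and> card S = n \<longrightarrow>
      (\<exists>M. k_matching k (delete_verts G S) M) \<and>
      (\<forall>M. k_matching k (delete_verts G S) M \<longrightarrow>
        (\<exists>M'. M \<subseteq> M' \<and> defect_matching d (delete_verts G S) M'))"
    using assms(2) unfolding nkd_graph_def by - (elim conjE, assumption)+
  have finV: "finite ?V" using G by (simp add: simple_graph_def)
  have edge: "f \<subseteq> ?V" "card f = 2" if "f \<in> edges G" for f
    using G that by (auto simp: simple_graph_def)
  obtain X where X: "\<forall>f\<in>edges G. \<exists>a b. a \<in> X \<and> b \<notin> X \<and> f = {a, b}"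
  proof -
    obtain X Y where XY: "X \<inter> Y = {}" "\<forall>f\<in>edges G. \<exists>x\<in>X. \<exists>y\<in>Y. f = {x, y}"
      using assms(3) unfolding bipartite_def by blast
    show ?thesis by (rule that[of X]) (use XY in fast)
  qed
  \<comment> \<open>After deleting \<open>n\<close> vertices a defect-\<open>d\<close> matching has
    \<open>k + m\<close> edges; after deleting only \<open>n - 2\<close> it needs
    \<open>k + m + 1\<close>. The size bound gives \<open>m \<ge> 1\<close>.\<close>
  obtain m where m: "card ?V = n + 2 * k + d + 2 * m" "m \<ge> 1"
  proof -
    obtain j where "card ?V - n - d = 2 * j" using parity by blast
    then have "card ?V = n + 2 * k + d + 2 * (j - k)" "j - k \<ge> 1" using size by linarith+
    then show ?thesis by (rule that)
  qed
  obtain x where x: "x \<in> e" using edge(2)[OF assms(4)] by fastforce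
  have xV: "x \<in> ?V" using x edge(1)[OF assms(4)] by blast
  \<comment> \<open>Since \<open>T\<close> has \<open>n - 2\<close> vertices, there is room in
    \<open>S\<close> for both ends of \<open>e\<close>, so a matching of \<open>G - S\<close> avoids
    \<open>e\<close>.\<close>
  have ex': "\<exists>M. k_matching k (delete_verts (delete_edge G e) T) M"
    if T: "T \<subseteq> ?V" "card T = n - 2" for T
  proof -
    have "card (T \<union> e) \<le> n"
      using card_Un_le[of T e] edge(2)[OF assms(4)] T(2) assms(1) by linarith
    then obtain S where S: "T \<union> e \<subseteq> S" "S \<subseteq> ?V" "card S = n"
      using exists_subset_between[of "T \<union> e" n ?V] T(1) edge(1)[OF assms(4)] finV size
      by auto
    obtain M where M: "k_matching k (delete_verts G S) M" using nkd S by blast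
    have "e \<notin> M" using M S x by (auto simp: k_matching_def delete_simps)
    then have "k_matching k (delete_verts (delete_edge G e) T) M"
      using M S(1) by (auto simp: k_matching_def delete_simps)
    then show ?thesis ..
  qed
  have extend': "\<exists>M'. M \<subseteq> M' \<and> defect_matching d (delete_verts (delete_edge G e) T) M'"
    if T: "T \<subseteq> ?V" "card T = n - 2" and M: "k_matching k (delete_verts (delete_edge G e) T) M"
    for T M
  proof -
    have finT: "finite T" using T(1) finV finite_subset by blast
    have MG: "matching G M" "e \<notin> M" "\<Union>M \<inter> T = {}" "card M = k"
      using M by (auto simp: k_matching_def delete_simps)
    note MU = matching_card_Union[OF G MG(1)]
    define W where "W = T \<union> \<Union>M"
    have W: "W \<subseteq> ?V" "finite W" using T(1) finT MU by (auto simp: W_def)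
    have "card W = n - 2 + 2 * k"
      unfolding W_def using card_Un_disjoint[OF finT MU(3)] MG(3,4) MU(2) T(2) by auto
    then have cardVW: "card (?V - W) = d + 2 + 2 * m"
      using m assms(1) W by (simp add: card_Diff_subset)
    define E where "E = {f \<in> edges G. f \<noteq> e \<and> f \<inter> W = {}}"
    have finE: "finite E"
    proof (rule finite_subset)
      show "E \<subseteq> Pow ?V" using edge by (auto simp: E_def)
    qed (simp add: finV)
    \<comment> \<open>\<open>M\<close> lacks \<open>m + 1\<close> edges, to be found among those of
      \<open>E\<close>, which avoid \<open>e\<close>, \<open>T\<close> and all vertices of
      \<open>M\<close>.\<close>
    have "\<exists>N \<subseteq> E. pairwise disjnt N \<and> card N = Suc m"
    proof (rule koenig[OF finE])
      show "\<forall>f\<in>E. \<exists>a b. a \<in> X \<and> b \<notin> X \<and> f = {a, b}" using X by (simp add: E_def)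
      fix C0 assume C0: "vertex_cover E C0"
      show "Suc m \<le> card C0"
      proof (rule ccontr)
        assume small: "\<not> Suc m \<le> card C0"
        \<comment> \<open>Vertices of \<open>W\<close> lie on no edge of \<open>E\<close>, and
          \<open>x\<close> will lie on no edge of \<open>M' - M\<close>, so neither helps to
          cover.\<close>
        define C where "C = C0 \<inter> (?V - W) - {x}"
        have finC: "finite C" and "card C \<le> card C0"
          using C0 by (auto simp: C_def vertex_cover_def intro!: card_mono)
        then have cardC: "card C \<le> m" using small by linarith
        have pick: "\<exists>c. c \<in> ?V - W \<and> c \<noteq> y" for y
        proof (rule ccontr)
          assume "\<not> ?thesis"
          then have "?V - W \<subseteq> {y}" by blast
          then have "card (?V - W) \<le> card {y}" by (intro card_mono) auto
          then show False using cardVW by simp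
        qed
        \<comment> \<open>If \<open>C\<close> is empty, \<open>c\<close> only serves to bring
          \<open>S\<close> up to \<open>n\<close> vertices.\<close>
        obtain c where c: "c \<in> ?V - W" "c \<noteq> x" "C \<noteq> {} \<Longrightarrow> c \<in> C"
        proof (cases "C = {}")
          case True then show ?thesis using pick[of x] that by blast
        next
          case False then show ?thesis using that by (auto simp: C_def)
        qed
        \<comment> \<open>If \<open>x\<close> is in \<open>W\<close>, no edge added to
          \<open>M\<close> can use it, and \<open>u\<close> is a mere filler; otherwise
          \<open>u\<close> is \<open>x\<close> itself.\<close>
        obtain u where u: "u \<in> ?V - W" "u \<noteq> c" "x \<in> insert u W"
        proof (cases "x \<in> W")
          case True then show ?thesis using pick[of c] that by blast
        next
          case False then show ?thesis using that[of x] c xV by blast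
        qed
        define S where "S = T \<union> {u, c}"
        have "card S = n"
          using finT u c T(2) assms(1) by (auto simp: S_def W_def)
        moreover have "S \<subseteq> ?V" using T u c by (auto simp: S_def)
        moreover have "k_matching k (delete_verts G S) M"
          using MG u c by (auto simp: k_matching_def delete_simps S_def W_def)
        ultimately obtain M' where M': "M \<subseteq> M'" "defect_matching d (delete_verts G S) M'"
          using nkd by blast
        have M'G: "matching G M'" "\<Union>M' \<inter> S = {}"
          and M'def: "card (\<Union>M') + d = card (?V - S)"
          using M'(2) by (auto simp: defect_matching_def delete_simps)
        have "card (?V - S) = 2 * k + d + 2 * m"
          using m \<open>card S = n\<close> \<open>S \<subseteq> ?V\<close> finV by (simp add: card_Diff_subset finite_subset)
        then have "card M' = k + m"
          using M'def matching_card_Union(2)[OF G M'G(1)] by linarith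
        then have cardN: "card (M' - M) = m"
          using M'(1) MU(1) MG(4) by (simp add: card_Diff_subset)
        \<comment> \<open>An edge of \<open>M' - M\<close> avoids \<open>W\<close>, \<open>u\<close>
          and \<open>c\<close>, hence also \<open>x\<close>. So it is not \<open>e\<close>, lies in
          \<open>E\<close>, and meets \<open>C0\<close> in a vertex that survives in
          \<open>C - {c}\<close>.\<close>
        have "vertex_cover (M' - M) (C - {c})"
          unfolding vertex_cover_def
        proof (intro conjI ballI)
          show "finite (C - {c})" using finC by simp
          fix f assume f: "f \<in> M' - M"
          then have fG: "f \<in> edges G" using M'G by (auto simp: matching_def)
          have "f \<inter> g = {}" if "g \<in> M" for g
            using that f M'G(1) M'(1) pairwiseD[of disjnt M' f g]
          by (auto simp: matching_def disjnt_def)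
          then have fW: "f \<inter> W = {}" using f M'G(2) by (auto simp: W_def S_def)
          have fuc: "u \<notin> f" "c \<notin> f" using f M'G(2) by (auto simp: S_def)
          then have "x \<notin> f" using u(3) fW by blast
          then have "f \<in> E" using fG fW x by (auto simp: E_def)
          then have "f \<inter> C0 \<noteq> {}" using C0 by (simp add: vertex_cover_def)
          then show "f \<inter> (C - {c}) \<noteq> {}"
            using fuc \<open>x \<notin> f\<close> fW edge(1)[OF fG] by (auto simp: C_def)
        qed
        moreover have "pairwise disjnt (M' - M)"
          using M'G(1) pairwise_subset[of disjnt M' "M' - M"] by (simp add: matching_def)
        ultimately have "m \<le> card (C - {c})"
          using card_matching_le_cover cardN by metis
        \<comment> \<open>For empty \<open>C\<close> the strict inequality rests on
          \<open>m \<ge> 1\<close>; otherwise removing \<open>c\<close> lowers a cardinality of at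
          most \<open>m\<close>.\<close>
        moreover have "card (C - {c}) < m"
        proof (cases "C = {}")
          case True then show ?thesis using m(2) by simp
        next
          case False then show ?thesis
            using c(3) cardC card_Diff1_less[OF finC, of c] by linarith
        qed
        ultimately show False by simp
      qed
    qed
    then obtain N where N: "N \<subseteq> E" "pairwise disjnt N" "card N = Suc m" by blast
    have N_M: "disjnt f g" if "f \<in> N" "g \<in> M" for f g
      using that N(1) by (auto simp: E_def W_def disjnt_def)
    have MN: "matching G (M \<union> N)"
      using MG(1) N N_M unfolding matching_def E_def pairwise_def
      by (auto simp: disjnt_sym)
    have eN: "e \<notin> M \<union> N" and TN: "\<Union>(M \<union> N) \<inter> T = {}"
      using N(1) MG(2,3) by (auto simp: E_def W_def)
    have "M \<inter> N = {}"
    proof (rule ccontr)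
      assume "M \<inter> N \<noteq> {}"
      then obtain f where f: "f \<in> M" "f \<in> N" by blast
      then have "f = {}" using N_M[of f f] by (simp add: disjnt_def)
      moreover have "f \<in> edges G" using f MG(1) by (auto simp: matching_def)
      ultimately show False using edge(2) by fastforce
    qed
    then have "card (M \<union> N) = k + Suc m"
      using card_Un_disjoint[of M N] MU(1) N finE MG(4) finite_subset by metis
    moreover have "card (?V - T) = card ?V - (n - 2)"
      using T finT by (simp add: card_Diff_subset)
    ultimately have "card (\<Union>(M \<union> N)) + d = card (?V - T)"
      using matching_card_Union(2)[OF G MN] m assms(1) by linarith
    then have "defect_matching d (delete_verts (delete_edge G e) T) (M \<union> N)"
      using MN eN TN unfolding defect_matching_def delete_simps by blast
    then show ?thesis by blast
  qed
  have "even (card ?V - (n - 2) - d)"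
  proof -
    have "card ?V - (n - 2) - d = 2 * (k + m + 1)" using m assms(1) by simp
    then show ?thesis by simp
  qed
  then show ?thesis
    unfolding nkd_graph_def
    using simple_graph_delete_edge[OF G] size ex' extend' by (simp add: verts_delete_edge)
qed

end
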